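(* Let $A=\mathbb{F}_q[t]$, where $q$ is a power of a prime $p$, and let $a\in A$. Call a monic irreducible $\wp\in A$ of degree $d$ an $a$-Wieferich prime if $a^{q^d}\equiv a\pmod{\wp^2}$. Then: (i) If there are infinitely many $a$-Wieferich primes, then $a=b^p$ for some $b\in A$, and then every monic irreducible polynomial of $A$ is $a$-Wieferich. (ii) There are no $a$-Wieferich primes if and only if $a=b^p+ct$ for some $b\in A$ and $c\in\mathbb{F}_q^*$. *)

theory Defs
  imports
    "HOL-Library.Cardinality"
    "HOL-Computational_Algebra.Polynomial_Factorial"
    "HOL-Number_Theory.Cong"
begin

text \<open>
  The type \<open>'a\<close> is the coefficient field itself, so \<open>q\<close> is \<open>CARD('a)\<close>.
  No coprimality of \<open>a\<close> and \<open>P\<close> is required.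
\<close>

definition wieferich_prime :: "'a::finite_field poly \<Rightarrow> 'a poly \<Rightarrow> bool" where
  "wieferich_prime a P \<longleftrightarrow>
     lead_coeff P = 1 \<and> irreducible P \<and>
     [a ^ (CARD('a) ^ degree P) = a] (mod P\<^sup>2)"

end

theory Submission
  imports Defs
begin

text \<open>
  By Fermat's theorem in the residue field, an irreducible \<open>P\<close> of degree \<open>d\<close> divides
  \<open>f = a ^ (q ^ d) - a\<close>, and \<open>f\<close> has derivative \<open>- a'\<close>. As the finite coefficient field is perfect, \<open>P\<close> is coprime
  to its own derivative, so \<open>P\<^sup>2\<close> divides \<open>f\<close> iff \<open>P\<close> divides \<open>f'\<close>: the Wieferich primes of \<open>a\<close>
  are exactly the prime divisors of \<open>a'\<close>. Both claims then follow because the polynomials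
  with vanishing derivative are the \<open>p\<close>-th powers.
\<close>

text \<open>Translation by \<open>1\<close> permutes the ring, so it leaves the sum of all elements unchanged.\<close>
lemma CHAR_dvd_CARD:
  "CHAR('a::{ring_1,finite}) dvd CARD('a)"
proof -
  have "(\<Sum>x\<in>UNIV. x) = (\<Sum>x\<in>UNIV. x + 1 :: 'a)"
    by (rule sum.reindex_bij_witness[of _ "\<lambda>x. x + 1" "\<lambda>x. x - 1"]) auto
  then have "of_nat CARD('a) = (0 :: 'a)" by (simp add: sum.distrib)
  then show ?thesis by (simp add: of_nat_eq_0_iff_char_dvd)
qed

lemma pderiv_power_CHAR:
  fixes b :: "'a::{comm_semiring_1,semiring_no_zero_divisors} poly"
  shows "pderiv (b ^ CHAR('a)) = 0"
  by (simp add: pderiv_power)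


text \<open>Only coefficients at multiples of \<open>p\<close> survive a vanishing derivative. Each
  of them has a \<open>p\<close>-th root in the finite field, and since Frobenius is additive, the
  root of \<open>a\<close> can be taken term by term.\<close>

lemma pderiv_eq_0_imp_power_CHAR:
  fixes a :: "'a::finite_field poly"
  assumes "pderiv a = 0"
  obtains b where "a = b ^ CHAR('a)"
proof -
  let ?p = "CHAR('a)"
  have "?p dvd CARD('a)" by (rule CHAR_dvd_CARD)
  then obtain r where r: "CARD('a) = r * ?p" by (auto simp: mult.commute)
  have coeff0: "coeff a n = 0" if nd: "\<not> ?p dvd n" for n
  proof -
    obtain k where k: "n = Suc k" using nd by (cases n) auto
    have "of_nat n * coeff a n = 0"
      using assms coeff_pderiv[of a k] by (simp add: k)
    then show ?thesis using nd by (simp add: of_nat_eq_0_iff_char_dvd)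
  qed
  \<comment> \<open>With \<open>r = q / p\<close>, the identity \<open>x ^ q = x\<close> makes
    \<open>x ^ r\<close> a \<open>p\<close>-th root of \<open>x\<close>.\<close>
  have root: "(x ^ r) ^ ?p = x" for x :: 'a
    using finite_field_power_card_eq_same[of x] by (simp only: r power_mult)
  \<comment> \<open>The bound \<open>degree a\<close> is generous: terms with
    \<open>?p * i > degree a\<close> are zero.\<close>
  define b where "b = (\<Sum>i\<le>degree a. monom (coeff a (?p * i) ^ r) i)"
  have "b ^ ?p = (\<Sum>i\<le>degree a. monom (coeff a (?p * i) ^ r) i ^ ?p)"
    unfolding b_def by (rule freshmans_dream_sum) auto
  also have "\<dots> = (\<Sum>i\<le>degree a. monom (coeff a (?p * i)) (i * ?p))"
    by (simp only: monom_power root)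
  also have "\<dots> = a"
  proof (rule poly_eqI)
    fix n
    have "coeff (\<Sum>i\<le>degree a. monom (coeff a (?p * i)) (i * ?p)) n =
            (\<Sum>i\<le>degree a. if i * ?p = n then coeff a n else 0)"
      by (auto simp: coeff_sum mult.commute intro!: sum.cong)
    also have "\<dots> = coeff a n"
    proof (cases "?p dvd n \<and> n \<le> degree a")
      case True
      then obtain j where j: "n = j * ?p" by (auto simp: mult.commute)
      have "i * ?p = n \<longleftrightarrow> i = j" for i using j by simp
      \<comment> \<open>This puts the single contributing index \<open>j\<close> inside the range of
        summation.\<close>
      moreover have "j \<le> n" unfolding j by (simp add: Suc_leI)
      ultimately show ?thesis using True by simp
    next
      case False
      then have "coeff a n = 0" using coeff0 by (auto simp: coeff_eq_0)
      then show ?thesis by (simp cong: if_cong)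
    qed
    finally show "coeff (\<Sum>i\<le>degree a. monom (coeff a (?p * i)) (i * ?p)) n = coeff a n" .
  qed
  finally show ?thesis using that by metis
qed

lemma pderiv_eq_0_iff_power_CHAR:
  fixes a :: "'a::finite_field poly"
  shows "pderiv a = 0 \<longleftrightarrow> (\<exists>b. a = b ^ CHAR('a))"
  by (metis pderiv_eq_0_imp_power_CHAR pderiv_power_CHAR)

lemma irreducible_imp_degree_pos:
  fixes P :: "'a::field poly"
  assumes "irreducible P"
  shows "degree P > 0"
  using assms by (auto simp: irreducible_def is_unit_iff_degree intro!: Nat.gr0I)

text \<open>For degree reasons the derivative would have to vanish, making \<open>P\<close> a
  \<open>p\<close>-th power, which is never irreducible.\<close>

lemma irreducible_not_dvd_pderiv:
  fixes P :: "'a::finite_field poly"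
  assumes "irreducible P"
  shows "\<not> P dvd pderiv P"
proof
  assume dvd: "P dvd pderiv P"
  have pos: "degree P > 0" by (rule irreducible_imp_degree_pos[OF assms])
  have "degree (pderiv P) < degree P"
    using pos by (intro degree_lessI) (auto simp: coeff_pderiv coeff_eq_0)
  then have "pderiv P = 0"
    using dvd dvd_imp_degree_le[of P "pderiv P"] by (meson not_less)
  then obtain b where b: "P = b ^ CHAR('a)" by (rule pderiv_eq_0_imp_power_CHAR)
  have "prime CHAR('a)" by simp
  then have "CHAR('a) > 1" by (rule prime_gt_1_nat)
  then have "P = b * b ^ (CHAR('a) - 1)" "CHAR('a) - 1 > 0"
    using b by (simp_all add: power_eq_if)
  then have "is_unit b"
    using assms irreducibleD is_unit_power_iff by (metis not_gr_zero)
  then have "is_unit P" unfolding b by (simp add: is_unit_power_iff)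
  then show False using assms by (simp add: irreducible_not_unit)
qed

text \<open>Coefficient lists of length exactly \<open>n\<close>, padded with zeros, biject with
  these polynomials. For \<open>n = 0\<close> the count would fail: the zero polynomial has degree
  0, so the set is empty.\<close>

lemma card_polys_degree_less:
  fixes n :: nat
  assumes "n > 0"
  shows "card {r :: 'a::{zero,finite} poly. degree r < n} = CARD('a) ^ n"
proof -
  let ?L = "{xs :: 'a list. set xs \<subseteq> UNIV \<and> length xs = n}"
  have "inj_on Poly ?L"
  proof (rule inj_onI)
    fix xs ys :: "'a list"
    assume *: "xs \<in> ?L" "ys \<in> ?L" "Poly xs = Poly ys"
    then have "nth_default 0 xs i = nth_default 0 ys i" for i by (metis coeff_Poly_eq)
    then show "xs = ys" using * by (intro nth_equalityI) (auto simp: nth_default_def, metis)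
  qed
  moreover have "Poly ` ?L = {r. degree r < n}"
  proof (intro equalityI subsetI)
    fix r :: "'a poly" assume "r \<in> Poly ` ?L"
    then show "r \<in> {r. degree r < n}" using assms
      by (auto intro!: degree_lessI simp: nth_default_def)
  next
    fix r :: "'a poly" assume r: "r \<in> {r. degree r < n}"
    have "r = Poly (map (coeff r) [0..<n])"
      using r by (intro poly_eqI) (auto simp: nth_default_def coeff_eq_0)
    then show "r \<in> Poly ` ?L" by (rule image_eqI) auto
  qed
  ultimately show ?thesis
    using card_image card_lists_length_eq[of "UNIV :: 'a set" n] by fastforce
qed

lemma finite_polys_degree_less:
  "finite {r :: 'a::{zero,finite} poly. degree r < n}"
proof (cases "n = 0")
  case False
  then show ?thesis
    using card_polys_degree_less[of n, where 'a = 'a] by (intro card_ge_0_finite) auto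
qed simp

lemma prime_elem_dvd_prodE:
  assumes "finite A" "prime_elem P" "P dvd prod f A"
  obtains x where "x \<in> A" "P dvd f x"
  using assms
  by (induction A arbitrary: thesis rule: finite_induct)
     (auto simp: prime_elem_dvd_mult_iff dest: prime_elem_not_unit)

text \<open>If \<open>P\<close> does not divide \<open>a\<close>, multiplication by \<open>a\<close>
  permutes the nonzero residues modulo \<open>P\<close>; comparing the products of all residues
  before and after yields Fermat's theorem.\<close>

lemma irreducible_dvd_power_minus_self:
  fixes P a :: "'a::finite_field poly"
  assumes "irreducible P"
  shows "P dvd a ^ (CARD('a) ^ degree P) - a"
proof (cases "P dvd a")
  case True
  then show ?thesis by (intro dvd_diff) (auto simp: dvd_power_iff intro: dvd_trans)
next
  case False
  \<comment> \<open>\<open>S\<close> represents the nonzero residue classes modulo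
    \<open>P\<close>.\<close>
  define S where "S = {r :: 'a poly. degree r < degree P} - {0}"
  have P: "prime_elem P" using assms by (rule field_poly_irreducible_imp_prime)
  have [simp]: "P \<noteq> 0" using assms by auto
  have pos: "degree P > 0" by (rule irreducible_imp_degree_pos[OF assms])
  have fin: "finite S" unfolding S_def using finite_polys_degree_less by blast
  have card: "Suc (card S) = CARD('a) ^ degree P"
    unfolding S_def using finite_polys_degree_less pos
    by (subst card_Suc_Diff1) (auto simp: card_polys_degree_less)
  have ndvd: "\<not> P dvd r" if "r \<in> S" for r
    using that dvd_imp_degree_le[of P r] by (auto simp: S_def)
  have inj: "inj_on (\<lambda>r. a * r mod P) S"
  proof (rule inj_onI)
    fix r s assume rs: "r \<in> S" "s \<in> S" "a * r mod P = a * s mod P"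
    then have "P dvd a * (r - s)" by (simp add: mod_eq_dvd_iff right_diff_distrib)
    then have "P dvd r - s" using P False by (simp add: prime_elem_dvd_mult_iff)
    moreover have "degree (r - s) < degree P"
      using rs by (intro degree_diff_less) (auto simp: S_def)
    ultimately show "r = s"
      using dvd_imp_degree_le[of P "r - s"] by fastforce
  qed
  have "(\<lambda>r. a * r mod P) ` S \<subseteq> S"
  proof (rule image_subsetI)
    fix r assume "r \<in> S"
    then have "\<not> P dvd a * r" using P False ndvd by (simp add: prime_elem_dvd_mult_iff)
    then have "a * r mod P \<noteq> 0" by auto
    then show "a * r mod P \<in> S" using degree_mod_less'[of P "a * r"] by (simp add: S_def)
  qed
  then have img: "(\<lambda>r. a * r mod P) ` S = S"
    using fin inj by (intro endo_inj_surj)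
  have "[(\<Prod>r\<in>S. a * r) = (\<Prod>r\<in>S. a * r mod P)] (mod P)"
    by (intro cong_prod) simp
  also have "(\<Prod>r\<in>S. a * r mod P) = \<Prod>S"
    using prod.reindex[OF inj, of "\<lambda>r. r"] img by simp
  finally have "P dvd (a ^ card S - 1) * \<Prod>S"
    by (simp add: cong_iff_dvd_diff prod.distrib left_diff_distrib)
  \<comment> \<open>\<open>P\<close> is prime and divides no element of \<open>S\<close>, so the
    product can be cancelled.\<close>
  moreover have "\<not> P dvd \<Prod>S" using prime_elem_dvd_prodE[OF fin P] ndvd by metis
  ultimately have "P dvd a ^ card S - 1" using P by (simp add: prime_elem_dvd_mult_iff)
  then have "P dvd a * (a ^ card S - 1)" by (rule dvd_mult)
  also have "a * (a ^ card S - 1) = a ^ Suc (card S) - a" by (simp add: algebra_simps)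
  finally show ?thesis by (simp only: card)
qed

text \<open>Write \<open>f = P * g\<close>. Modulo \<open>P\<close> the derivative of
  \<open>f\<close> is \<open>g * pderiv P\<close>, and \<open>P\<close> divides this iff it divides
  \<open>g\<close>.\<close>

lemma prime_elem_square_dvd_iff_dvd_pderiv:
  fixes P f :: "'a::field poly"
  assumes "prime_elem P" "\<not> P dvd pderiv P" "P dvd f"
  shows "P\<^sup>2 dvd f \<longleftrightarrow> P dvd pderiv f"
proof -
  obtain g where f: "f = P * g" using assms by blast
  have "P\<^sup>2 dvd f \<longleftrightarrow> P dvd g"
    using assms(1) unfolding f power2_eq_square by (auto simp: dvd_mult_cancel_left)
  also have "\<dots> \<longleftrightarrow> P dvd g * pderiv P"
    using assms by (simp add: prime_elem_dvd_mult_iff)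
  also have "\<dots> \<longleftrightarrow> P dvd pderiv f"
    by (simp add: f pderiv_mult dvd_add_right_iff)
  finally show ?thesis .
qed

lemma wieferich_prime_iff:
  "wieferich_prime a P \<longleftrightarrow> lead_coeff P = 1 \<and> irreducible P \<and> P dvd pderiv a"
proof (cases "irreducible P")
  case True
  let ?n = "CARD('a) ^ degree P"
  have "CHAR('a) dvd ?n"
    using irreducible_imp_degree_pos[OF True] CHAR_dvd_CARD[where 'a = 'a]
    by (meson dvd_power dvd_trans)
  \<comment> \<open>The exponent vanishes in the field, so the power of \<open>a\<close> contributes
    nothing to the derivative.\<close>
  then have "of_nat ?n = (0 :: 'a)" by (simp only: of_nat_eq_0_iff_char_dvd)
  then have "pderiv (a ^ ?n - a) = - pderiv a"
    by (simp only: pderiv_diff pderiv_power smult_0_left mult_zero_left diff_0)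
  then have "P\<^sup>2 dvd a ^ ?n - a \<longleftrightarrow> P dvd pderiv a"
    using prime_elem_square_dvd_iff_dvd_pderiv[OF field_poly_irreducible_imp_prime[OF True]
        irreducible_not_dvd_pderiv[OF True] irreducible_dvd_power_minus_self[OF True, of a]]
    by simp
  then show ?thesis using True by (simp add: wieferich_prime_def cong_iff_dvd_diff)
qed (simp add: wieferich_prime_def)

text \<open>A divisor of least positive degree is irreducible; scaling by the inverse leading
  coefficient makes it monic.\<close>

lemma monic_irreducible_divisor_exists:
  fixes f :: "'a::field poly"
  assumes "degree f > 0"
  obtains P where "lead_coeff P = 1" "irreducible P" "P dvd f"
proof -
  obtain g where g: "degree g > 0" "g dvd f"
    and min: "\<And>h. degree h > 0 \<Longrightarrow> h dvd f \<Longrightarrow> degree g \<le> degree h"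
    using ex_has_least_nat[of "\<lambda>g. degree g > 0 \<and> g dvd f" f degree] assms by auto
  have g0: "g \<noteq> 0" using g by auto
  have "irreducible g"
  proof (rule irreducibleI)
    fix u v assume uv: "g = u * v"
    show "is_unit u \<or> is_unit v"
    proof (rule ccontr)
      assume "\<not> (is_unit u \<or> is_unit v)"
      then have "degree u > 0" "degree v > 0" using uv g0 by (auto simp: is_unit_iff_degree)
      then show False
        using min[of u] uv g g0 by (auto simp: degree_mult_eq dest: dvd_mult_left)
    qed
  qed (use g g0 in \<open>auto simp: is_unit_iff_degree\<close>)
  define P where "P = smult (inverse (lead_coeff g)) g"
  show ?thesis
  proof
    show "lead_coeff P = 1" using g0 by (simp add: P_def)
    have "P = [:inverse (lead_coeff g):] * g" by (simp add: P_def)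
    then show "irreducible P"
      using \<open>irreducible g\<close> g0 irreducible_mult_unit_left[of "[:inverse (lead_coeff g):]" g]
      by (simp add: is_unit_pCons_iff)
    show "P dvd f" using g g0 by (simp add: P_def smult_dvd_iff)
  qed
qed

theorem theorem2:
  fixes a :: "'a::finite_field poly" and p m :: nat
  assumes "prime p" and "m \<ge> 1" and "CARD('a) = p ^ m"
  shows "(infinite {P. wieferich_prime a P} \<longrightarrow> (\<exists>b. a = b ^ p))
       \<and> ((\<exists>b. a = b ^ p) \<longrightarrow>
            (\<forall>P. lead_coeff P = 1 \<and> irreducible P \<longrightarrow> wieferich_prime a P))
       \<and> ((\<nexists>P. wieferich_prime a P) \<longleftrightarrow>
            (\<exists>b c. c \<noteq> 0 \<and> a = b ^ p + smult c [:0, 1:]))"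
proof -
  have "CHAR('a) dvd p ^ m" using CHAR_dvd_CARD[where 'a = 'a] assms by simp
  then have "CHAR('a) dvd p" by (rule prime_dvd_power[rotated]) simp
  then have p: "p = CHAR('a)" using assms(1) by (intro primes_dvd_imp_eq[symmetric]) simp_all
  have power_iff: "(\<exists>b. f = b ^ p) \<longleftrightarrow> pderiv f = 0" for f :: "'a poly"
    by (simp add: p pderiv_eq_0_iff_power_CHAR)
  \<comment> \<open>Divisors of the nonzero polynomial \<open>pderiv a\<close> have bounded degree,
    and the coefficient field is finite.\<close>
  have "finite {P. wieferich_prime a P}" if "pderiv a \<noteq> 0"
  proof (rule finite_subset[OF _ finite_polys_degree_less])
    show "{P. wieferich_prime a P} \<subseteq> {P. degree P < Suc (degree (pderiv a))}"
      using that by (auto simp: wieferich_prime_iff less_Suc_eq_le dvd_imp_degree_le)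
  qed
  moreover have "(\<nexists>P. wieferich_prime a P) \<longleftrightarrow> (\<exists>c. c \<noteq> 0 \<and> pderiv a = [:c:])"
  proof
    assume none: "\<nexists>P. wieferich_prime a P"
    have "degree (pderiv a) = 0"
      using none monic_irreducible_divisor_exists by (metis wieferich_prime_iff not_gr_zero)
    \<comment> \<open>Otherwise every monic irreducible would be Wieferich, and one exists, as a
      divisor of \<open>t\<close>.\<close>
    moreover have "pderiv a \<noteq> 0"
      using none monic_irreducible_divisor_exists[of "[:0, 1 :: 'a:]"]
      by (metis wieferich_prime_iff dvd_0_right degree_pCons_eq_if one_neq_zero pCons_eq_0_iff zero_less_Suc)
    ultimately show "\<exists>c. c \<noteq> 0 \<and> pderiv a = [:c:]"
      by (metis degree_eq_zeroE pCons_0_0)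
  next
    assume "\<exists>c. c \<noteq> 0 \<and> pderiv a = [:c:]"
    then obtain c where c: "c \<noteq> 0" "pderiv a = [:c:]" by blast
    then show "\<nexists>P. wieferich_prime a P"
      using dvd_imp_degree_le[of _ "[:c:]"] irreducible_imp_degree_pos
      by (fastforce simp: wieferich_prime_iff)
  qed
  moreover have "pderiv a = [:c:] \<longleftrightarrow> (\<exists>b. a = b ^ p + smult c [:0, 1:])" for c
  proof -
    \<comment> \<open>\<open>[:0, 1:]\<close> is \<open>t\<close>, with derivative 1, so subtracting
      \<open>c * t\<close> reduces to a vanishing derivative.\<close>
    have "pderiv a = [:c:] \<longleftrightarrow> pderiv (a - smult c [:0, 1:]) = 0"
      by (simp add: pderiv_diff pderiv_smult pderiv_pCons)
    then show ?thesis by (simp add: power_iff[symmetric] diff_eq_eq)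
  qed
  ultimately show ?thesis
    unfolding power_iff by (auto simp: wieferich_prime_iff)
qed

end
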